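(* Let $p$ be an odd prime, $n\ge 0$, and for $\psi\in\{\chi_0,\chi_p\}$ let $c_\psi(s)_{ij}$ ($0\le i,j\le n$) be the $(i,j)$-entry of the inverse of the upper triangular matrix $B_\psi(s)=(b_\psi(s)_{ij})_{0\le i,j\le n}$. Then, as rational functions of $p^{-s}$: (1) For $\psi=\chi_0$ and $0\le i\le j\le n$, $$c_{\chi_0}(s)_{ij}=\frac{p^{\frac{(j-i)(j-i+2)}4-(j-i)s}(1-p^{i-s})\prod_{k=i+1}^j(p^k-1)}{(1-p^{j-s})\prod_{k=1}^{(j-i)/2}(1-p^{i+j-1+2k-2s})(p^{2k}-1)}\quad\text{if } i\equiv j\bmod2,$$ $$c_{\chi_0}(s)_{ij}=\frac{p^{\frac{(j-i)^2-1}4-(j-i)s}\prod_{k=i+1}^j(p^k-1)}{(1-p^{j-s})\prod_{k=1}^{(j-i-1)/2}(1-p^{i+j+2k-2s})(p^{2k}-1)}\quad\text{if } i\not\equiv j\bmod2.$$ (2) For $\psi=\chi_p$ and $0\le i\le j\le n$ with $i\equiv j\bmod2$, $$c_{\chi_p}(s)_{ij}=\frac{\chi_p(-1)^{\frac{j-i}2}\,p^{\frac{j-i}2(\frac{j-i}2-2s)}\prod_{k=i+1}^j(p^k-1)}{\prod_{k=1}^{(j-i)/2}(1-p^{i+j-1+2k-2s})(p^{2k}-1)}.$$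
   Context: $p$ is a fixed odd prime; $\chi_0$ is the trivial and $\chi_p=(\frac{\cdot}{p})$ the quadratic Dirichlet character modulo $p$. Empty products equal $1$. For $0\le i\le j$ let $$m_{\chi_0}(s)_{ij}=\frac{p^{si-\frac{j(j+1)}2+\frac{(j-i)(j-i+2)}4}\prod_{r=i+1}^j(p^r-1)}{\prod_{r=1}^{(j-i)/2}(p^{2r}-1)}\ (j-i\text{ even}),$$ $$m_{\chi_0}(s)_{ij}=\frac{p^{si-\frac{j(j+1)}2+\frac{(j-i)^2-1}4}\prod_{r=i+1}^j(p^r-1)}{\prod_{r=1}^{(j-i-1)/2}(p^{2r}-1)}\ (j-i\text{ odd}),$$ $$m_{\chi_p}(s)_{ij}=\frac{\chi_p(-1)^{\frac{j-i}2}p^{si-\frac{j(j+1)}2+\frac{(j-i)^2}4}\prod_{k=i+1}^j(p^k-1)}{\prod_{k=1}^{(j-i)/2}(p^{2k}-1)}\ (j-i\text{ even}),\qquad m_{\chi_p}(s)_{ij}=0\ (j-i\text{ odd}).$$ (For $i>j$, $m_\psi(s)_{ij}=0$.) Define $b_\psi(s)_{ij}$ inductively by $b_\psi(s)_{ij}=0$ for $i>j$, $b_\psi(s)_{ii}=1$, and for $i<j$ $$b_\psi(s)_{ij}=\frac{p^{-js+j(j+1)/2}}{p^{(j-i)((j+i+1)/2-s)}-1}\sum_{k=i}^{j-1}m_\psi(s)_{kj}\,b_\psi(s)_{ik}.$$ *)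

theory Defs
  imports
    "HOL-Analysis.Complex_Transcendental"
    "HOL-Computational_Algebra.Fraction_Field"
    "HOL-Computational_Algebra.Polynomial"
    "HOL-Number_Theory.Number_Theory"
    "Jordan_Normal_Form.Matrix"
begin

text \<open>
  Everything is a rational function of the quantity \<open>p\<^bsup>-s\<^esup>\<close>. All objects are therefore
  defined over an arbitrary field, with a parameter \<open>x\<close> in the role of \<open>p\<^bsup>-s\<^esup>\<close>;
  \<open>p_pow p x a b\<close> is \<open>p\<^bsup>a + b s\<^esup>\<close>. Identities of rational functions of \<open>p\<^bsup>-s\<^esup>\<close> are
  identities in the field of rational functions, with \<open>x\<close> taken to be the
  indeterminate \<open>ratfun_X\<close>.
\<close>

definition p_pow :: "nat \<Rightarrow> 'a::field \<Rightarrow> int \<Rightarrow> int \<Rightarrow> 'a" where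
  "p_pow p x a b = of_nat p powi a * x powi (- b)"

lemma p_pow_complex:
  fixes s :: complex
  assumes "p > 0"
  shows "p_pow p (of_nat p powr (- s)) a b = of_nat p powr (of_int a + of_int b * s)"
proof -
  define q :: complex where "q = of_nat p"
  have q: "q \<noteq> 0"
    using assms by (simp add: q_def)
  have "q powi a = exp (of_int a * ln q)"
    using q by (metis exp_Ln exp_power_int)
  moreover have "(q powr (- s)) powi (- b) = exp (of_int (- b) * (- s * ln q))"
    using q by (simp only: powr_def if_False exp_power_int)
  ultimately have "q powi a * (q powr (- s)) powi (- b) = q powr (of_int a + of_int b * s)"
    using q by (simp add: powr_def exp_add [symmetric] algebra_simps)
  then show ?thesis
    by (simp add: p_pow_def q_def)
qed

definition ratfun_X :: "complex poly fract" where
  "ratfun_X = Fract [:0, 1:] 1"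

text \<open>
  In the exponents below every \<open>div\<close> by 2 or 4 is exact (in the respective
  parity case), so it agrees with division of rational numbers.
\<close>

definition m_chi0 :: "nat \<Rightarrow> 'a::field \<Rightarrow> nat \<Rightarrow> nat \<Rightarrow> 'a" where
  "m_chi0 p x i j =
    (let I = int i; J = int j in
     if i > j then 0
     else if even (j - i) then
       p_pow p x (- (J * (J + 1) div 2) + (J - I) * (J - I + 2) div 4) I
         * (\<Prod>r = i+1..j. of_nat p ^ r - 1)
         / (\<Prod>r = 1..(j - i) div 2. of_nat p ^ (2 * r) - 1)
     else
       p_pow p x (- (J * (J + 1) div 2) + ((J - I)\<^sup>2 - 1) div 4) I
         * (\<Prod>r = i+1..j. of_nat p ^ r - 1)
         / (\<Prod>r = 1..(j - i - 1) div 2. of_nat p ^ (2 * r) - 1))"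

definition m_chip :: "nat \<Rightarrow> 'a::field \<Rightarrow> nat \<Rightarrow> nat \<Rightarrow> 'a" where
  "m_chip p x i j =
    (let I = int i; J = int j in
     if i > j then 0
     else if even (j - i) then
       of_int (Legendre (- 1) (int p)) ^ ((j - i) div 2)
         * p_pow p x (- (J * (J + 1) div 2) + (J - I)\<^sup>2 div 4) I
         * (\<Prod>k = i+1..j. of_nat p ^ k - 1)
         / (\<Prod>k = 1..(j - i) div 2. of_nat p ^ (2 * k) - 1)
     else 0)"

text \<open>
  The recursion is common to both characters; \<open>m\<close> is the coefficient array of the
  character in question. The exponent \<open>(j - i) ((j + i + 1) / 2 - s)\<close> is split as
  \<open>(j - i) (j + i + 1) / 2 - (j - i) s\<close>.
\<close>

function b_entry :: "(nat \<Rightarrow> nat \<Rightarrow> 'a::field) \<Rightarrow> nat \<Rightarrow> 'a \<Rightarrow> nat \<Rightarrow> nat \<Rightarrow> 'a" where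
  "b_entry m p x i j =
    (let I = int i; J = int j in
     if i > j then 0
     else if i = j then 1
     else p_pow p x (J * (J + 1) div 2) (- J)
          / (p_pow p x ((J - I) * (J + I + 1) div 2) (- (J - I)) - 1)
          * (\<Sum>k = i..<j. m k j * b_entry m p x i k))"
  by pat_completeness auto
termination
  by (relation "measure (\<lambda>(m, p, x, i, j). j)") auto

declare b_entry.simps [simp del]

definition B_chi0 :: "nat \<Rightarrow> 'a::field \<Rightarrow> nat \<Rightarrow> 'a mat" where
  "B_chi0 p x n = mat (n + 1) (n + 1) (\<lambda>(i, j). b_entry (m_chi0 p x) p x i j)"

definition B_chip :: "nat \<Rightarrow> 'a::field \<Rightarrow> nat \<Rightarrow> 'a mat" where
  "B_chip p x n = mat (n + 1) (n + 1) (\<lambda>(i, j). b_entry (m_chip p x) p x i j)"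

definition is_inverse_mat :: "'a::semiring_1 mat \<Rightarrow> 'a mat \<Rightarrow> bool" where
  "is_inverse_mat C A \<longleftrightarrow>
    C \<in> carrier_mat (dim_col A) (dim_row A) \<and> inverts_mat A C \<and> inverts_mat C A"

end

theory Submission
  imports Defs "Jordan_Normal_Form.Determinant"
begin

text \<open>
  Put \<open>d\<^sub>j = m\<^sub>j\<^sub>j = p\<^bsup>sj - j(j+1)/2\<^esup>\<close> and \<open>D = diag(d\<^sub>0, \<dots>, d\<^sub>n)\<close>. Cleared of denominators, the
  recursion for \<open>b\<close> says \<open>B m = D B\<close>: the rows of \<open>B\<close> are left eigenvectors of \<open>m\<close>. If the matrix
  \<open>C\<close> of the claimed entries satisfies \<open>m C = C D\<close>, then \<open>B C\<close> commutes with \<open>D\<close>; being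
  unitriangular, and the \<open>d\<^sub>j\<close> being distinct, it is the identity.

  Splitting \<open>\<Sum>\<^sub>k m\<^sub>i\<^sub>k c\<^sub>k\<^sub>j\<close> by the parity of \<open>j - k\<close>, the relation \<open>m C = C D\<close> reduces in every case
  to the finite \<open>q\<close>-series identity
  \<open>\<Sum>\<^sub>r (y Q\<^bsup>1-l\<^esup>)\<^sup>r / ([r]! [l-r]! (y)\<^sub>r) = 1 / ([l]! (y)\<^sub>l)\<close> with \<open>Q = p\<^sup>2\<close>, \<open>y = p\<^bsup>2j-1-2s\<^esup>\<close>,
  \<open>[l]! = \<Prod>\<^bsub>k\<le>l\<^esub> (Q\<^sup>k - 1)\<close> and \<open>(y)\<^sub>r = \<Prod>\<^bsub>u<r\<^esub> (1 - y Q\<^bsup>-u\<^esup>)\<close>, which follows by induction on \<open>l\<close>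
  from \<open>Q\<^bsup>l+1\<^esup> - 1 = (Q\<^bsup>l+1-r\<^esup> - 1) + (Q\<^bsup>l+1\<^esup> - Q\<^bsup>l+1-r\<^esup>)\<close>.
\<close>

section \<open>The finite q-series identity\<close>

definition qfact :: "'a::field \<Rightarrow> nat \<Rightarrow> 'a" where
  "qfact Q l = (\<Prod>k = 1..l. Q ^ k - 1)"

text \<open>The q-Pochhammer symbol of \<open>y\<close> in base \<open>1 / Q\<close>. With this
  base, passing from \<open>y\<close> to \<open>y / Q\<close> is a shift of the index, which drives
  the induction in \<open>sum_qterm\<close>.\<close>

definition qpoch :: "'a::field \<Rightarrow> 'a \<Rightarrow> nat \<Rightarrow> 'a" where
  "qpoch Q y s = (\<Prod>u<s. 1 - y / Q ^ u)"

lemma qfact_0 [simp]: "qfact Q 0 = 1"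
  by (simp add: qfact_def)

lemma qfact_Suc: "qfact Q (Suc l) = qfact Q l * (Q ^ Suc l - 1)"
  by (simp add: qfact_def)

lemma qfact_nonzero:
  assumes "\<And>k. k > 0 \<Longrightarrow> Q ^ k \<noteq> 1"
  shows "qfact Q l \<noteq> 0"
  using assms by (auto simp: qfact_def)

lemma qpoch_0 [simp]: "qpoch Q y 0 = 1"
  by (simp add: qpoch_def)

lemma qpoch_Suc: "qpoch Q y (Suc s) = qpoch Q y s * (1 - y / Q ^ s)"
  by (simp add: qpoch_def)

lemma qpoch_Suc_shift: "qpoch Q y (Suc s) = (1 - y) * qpoch Q (y / Q) s"
  by (simp add: qpoch_def prod.lessThan_Suc_shift del: prod.lessThan_Suc)

lemma qpoch_nonzero:
  assumes "Q \<noteq> 0" "\<And>u. y \<noteq> Q ^ u"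
  shows "qpoch Q y s \<noteq> 0"
  using assms by (auto simp: qpoch_def)

definition qterm :: "'a::field \<Rightarrow> 'a \<Rightarrow> nat \<Rightarrow> nat \<Rightarrow> 'a" where
  "qterm Q y l s = (y * Q / Q ^ l) ^ s / (qfact Q s * qfact Q (l - s) * qpoch Q y s)"

text \<open>\<open>Q ^ (Suc l - s) - 1\<close> is the last factor of
  \<open>qfact Q (Suc l - s)\<close> and cancels. Splitting either end factor off
  \<open>qpoch Q y (Suc s)\<close> trades \<open>qpoch Q y s\<close> for
  \<open>qpoch Q (y / Q) s\<close>.\<close>

lemma qterm_Suc_low:
  assumes Q: "Q \<noteq> 0" "\<And>k. k > 0 \<Longrightarrow> Q ^ k \<noteq> 1" and y: "\<And>u. y \<noteq> Q ^ u" and s: "s \<le> l"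
  shows "(Q ^ (Suc l - s) - 1) * qterm Q y (Suc l) s = qterm Q (y / Q) l s * (1 - y / Q ^ s) / (1 - y)"
proof -
  have "qfact Q (Suc l - s) = qfact Q (l - s) * (Q ^ (Suc l - s) - 1)"
    using s by (simp add: Suc_diff_le qfact_Suc)
  moreover have "Q ^ (Suc l - s) - 1 \<noteq> 0" using Q(2)[of "Suc l - s"] s by simp
  moreover have "(1 - y / Q ^ s) * qpoch Q y s = (1 - y) * qpoch Q (y / Q) s"
    by (metis qpoch_Suc qpoch_Suc_shift mult.commute)
  moreover have "1 - y \<noteq> 0" "1 - y / Q ^ s \<noteq> 0" using y[of 0] y[of s] Q by auto
  moreover have "qpoch Q y s \<noteq> 0" using Q y by (intro qpoch_nonzero)
  moreover have "qpoch Q (y / Q) s \<noteq> 0"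
    using Q y by (intro qpoch_nonzero) (auto simp: field_simps simp flip: power_Suc power_Suc2)
  moreover have "y * Q / Q ^ Suc l = (y / Q) * Q / Q ^ l" using Q by simp
  ultimately show ?thesis
    using Q qfact_nonzero[of Q s] qfact_nonzero[of Q "l - s"]
    unfolding qterm_def by (simp add: divide_simps)
qed

text \<open>In \<open>Q ^ Suc l - Q ^ (l - s) = Q ^ (l - s) * (Q ^ Suc s - 1)\<close> the second
  factor cancels against \<open>qfact Q (Suc s)\<close>, and the first turns the surplus base
  \<open>y / Q ^ l\<close> into \<open>y / Q ^ s\<close>.\<close>

lemma qterm_Suc_high:
  assumes Q: "Q \<noteq> 0" "\<And>k. k > 0 \<Longrightarrow> Q ^ k \<noteq> 1" and y: "\<And>u. y \<noteq> Q ^ u" and s: "s \<le> l"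
  shows "(Q ^ Suc l - Q ^ (l - s)) * qterm Q y (Suc l) (Suc s) = qterm Q (y / Q) l s * (y / Q ^ s) / (1 - y)"
proof -
  have "Q ^ l = Q ^ s * Q ^ (l - s)" using s by (simp flip: power_add)
  moreover have "Q ^ Suc s - 1 \<noteq> 0" using Q(2)[of "Suc s"] by simp
  ultimately show ?thesis
    using Q qfact_nonzero[of Q s] qfact_nonzero[of Q "l - s"] y[of 0]
    unfolding qterm_def by (simp add: qpoch_Suc_shift qfact_Suc divide_simps) (simp add: algebra_simps)
qed

text \<open>The induction generalises over \<open>y\<close>, since both halves of the split sum lead
  to terms of level \<open>l\<close> at \<open>y / Q\<close>. Their weights
  \<open>1 - y / Q ^ s\<close> and \<open>y / Q ^ s\<close> add up to 1.\<close>

lemma sum_qterm: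
  assumes Q: "Q \<noteq> 0" "\<And>k. k > 0 \<Longrightarrow> Q ^ k \<noteq> 1" and y: "\<And>u. y \<noteq> Q ^ u"
  shows "(\<Sum>s\<le>l. qterm Q y l s) = 1 / (qfact Q l * qpoch Q y l)"
  using y
proof (induction l arbitrary: y)
  case 0
  then show ?case by (simp add: qterm_def)
next
  case (Suc l)
  have y': "y / Q \<noteq> Q ^ u" for u
    using Suc.prems[of "Suc u"] Q by (auto simp: field_simps)
  have nz: "Q ^ Suc l - 1 \<noteq> 0" "1 - y \<noteq> 0" using Q(2)[of "Suc l"] Suc.prems[of 0] by auto
  have "(Q ^ Suc l - 1) * (\<Sum>s\<le>Suc l. qterm Q y (Suc l) s)
      = (\<Sum>s\<le>Suc l. (Q ^ (Suc l - s) - 1) * qterm Q y (Suc l) s)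
        + (\<Sum>s\<le>Suc l. (Q ^ Suc l - Q ^ (Suc l - s)) * qterm Q y (Suc l) s)"
    unfolding sum.distrib[symmetric] distrib_right[symmetric] sum_distrib_left by simp
  \<comment> \<open>The term \<open>s = Suc l\<close> carries the factor
    \<open>Q ^ 0 - 1 = 0\<close>.\<close>
  also have "(\<Sum>s\<le>Suc l. (Q ^ (Suc l - s) - 1) * qterm Q y (Suc l) s)
      = (\<Sum>s\<le>l. qterm Q (y / Q) l s * (1 - y / Q ^ s) / (1 - y))"
    using qterm_Suc_low[OF Q Suc.prems, of _ l] by simp
  \<comment> \<open>The term \<open>s = 0\<close> vanishes, so the index can be shifted by
    one.\<close>
  also have "(\<Sum>s\<le>Suc l. (Q ^ Suc l - Q ^ (Suc l - s)) * qterm Q y (Suc l) s)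
      = (\<Sum>s\<le>l. qterm Q (y / Q) l s * (y / Q ^ s) / (1 - y))"
    using qterm_Suc_high[OF Q Suc.prems, of _ l] by (simp add: sum.atMost_Suc_shift del: sum.atMost_Suc)
  also have "(\<Sum>s\<le>l. qterm Q (y / Q) l s * (1 - y / Q ^ s) / (1 - y))
        + (\<Sum>s\<le>l. qterm Q (y / Q) l s * (y / Q ^ s) / (1 - y))
      = (\<Sum>s\<le>l. qterm Q (y / Q) l s / (1 - y))"
    unfolding sum.distrib[symmetric] add_divide_distrib[symmetric] distrib_left[symmetric] by simp
  also have "\<dots> = 1 / (qfact Q l * qpoch Q (y / Q) l) / (1 - y)"
    by (simp add: Suc.IH[OF y'] flip: sum_divide_distrib)
  finally have "(\<Sum>s\<le>Suc l. qterm Q y (Suc l) s)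
      = 1 / (qfact Q l * qpoch Q (y / Q) l) / (1 - y) / (Q ^ Suc l - 1)"
    using nz(1) by (metis nonzero_mult_div_cancel_left)
  then show ?case
    by (simp add: qfact_Suc qpoch_Suc_shift mult_ac)
qed

section \<open>Splitting sums by parity\<close>

lemma sum_parity_even:
  fixes f :: "nat \<Rightarrow> 'a::comm_monoid_add"
  shows "(\<Sum>k = i..i + 2 * l. f k)
    = (\<Sum>s\<le>l. f (i + 2 * l - 2 * s)) + (\<Sum>s<l. f (i + 2 * l - (2 * s + 1)))"
proof -
  \<comment> \<open>After reversal the index is the distance to the upper end, whose parity selects
    the formula for the entry of the inverse.\<close>
  have "(\<Sum>k = i..i + 2 * l. f k) = (\<Sum>t\<le>2 * l. f (i + 2 * l - t))"
    by (rule sum.reindex_bij_witness[of _ "\<lambda>t. i + 2 * l - t" "\<lambda>k. i + 2 * l - k"]) auto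
  moreover have "(\<Sum>t\<le>2 * l. g t) = (\<Sum>s\<le>l. g (2 * s)) + (\<Sum>s<l. g (2 * s + 1))" for g :: "nat \<Rightarrow> 'a"
    by (induction l) (simp_all add: add_ac)
  ultimately show ?thesis by simp
qed

lemma sum_parity_odd:
  fixes f :: "nat \<Rightarrow> 'a::comm_monoid_add"
  shows "(\<Sum>k = i..i + 2 * l + 1. f k)
    = (\<Sum>s\<le>l. f (i + 2 * l + 1 - 2 * s)) + (\<Sum>s\<le>l. f (i + 2 * l + 1 - (2 * s + 1)))"
proof -
  have "(\<Sum>k = i..i + 2 * l + 1. f k) = (\<Sum>t\<le>2 * l + 1. f (i + 2 * l + 1 - t))"
    by (rule sum.reindex_bij_witness[of _ "\<lambda>t. i + 2 * l + 1 - t" "\<lambda>k. i + 2 * l + 1 - k"]) auto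
  moreover have "(\<Sum>t\<le>2 * l + 1. g t) = (\<Sum>s\<le>l. g (2 * s)) + (\<Sum>s\<le>l. g (2 * s + 1))" for g :: "nat \<Rightarrow> 'a"
    by (induction l) (simp_all add: add_ac)
  ultimately show ?thesis by (simp only:)
qed

section \<open>Inverting a matrix of left eigenvectors\<close>

lemma inverse_of_eigenvector_matrices:
  fixes b c m :: "nat \<Rightarrow> nat \<Rightarrow> 'a::field" and d :: "nat \<Rightarrow> 'a"
  assumes b: "\<And>i j. j < i \<Longrightarrow> b i j = 0" "\<And>i. b i i = 1"
    and c: "\<And>i j. j < i \<Longrightarrow> c i j = 0" "\<And>i. c i i = 1"
    and left: "\<And>i j. i \<le> j \<Longrightarrow> (\<Sum>k = i..j. b i k * m k j) = d i * b i j"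
    and right: "\<And>i j. i \<le> j \<Longrightarrow> (\<Sum>k = i..j. m i k * c k j) = d j * c i j"
    and d: "\<And>i j. i < j \<Longrightarrow> d i \<noteq> d j"
  shows "is_inverse_mat (mat (n + 1) (n + 1) (\<lambda>(i, j). c i j)) (mat (n + 1) (n + 1) (\<lambda>(i, j). b i j))"
proof -
  have e: "(\<Sum>k = i..j. b i k * c k j) = (if i = j then 1 else 0)" if "i \<le> j" for i j
  proof (cases "i = j")
    case False
    \<comment> \<open>The \<open>(i, j)\<close> entry of the triple product \<open>b m c\<close> is
      computed in two ways, by \<open>left\<close> and, after interchanging the sums over the
      triangle i \<le> t \<le> k \<le> j, by \<open>right\<close>. So \<open>d i\<close> and
      \<open>d j\<close> multiply the same sum to the same value.\<close>
    have "d i * (\<Sum>k = i..j. b i k * c k j) = (\<Sum>k = i..j. (\<Sum>t = i..k. b i t * m t k) * c k j)"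
      by (simp add: left sum_distrib_left mult_ac)
    also have "\<dots> = (\<Sum>k = i..j. \<Sum>t = i..k. b i t * (m t k * c k j))"
      by (simp add: sum_distrib_right mult.assoc)
    also have "\<dots> = (\<Sum>t = i..j. \<Sum>k = t..j. b i t * (m t k * c k j))"
      unfolding sum.Sigma[OF finite_atLeastAtMost ballI[OF finite_atLeastAtMost]]
      by (rule sum.reindex_bij_witness[of _ "\<lambda>(a, b). (b, a)" "\<lambda>(a, b). (b, a)"]) auto
    also have "\<dots> = d j * (\<Sum>k = i..j. b i k * c k j)"
      by (simp add: right mult.left_commute flip: sum_distrib_left)
    finally show ?thesis using d[of i j] that False by auto
  qed (simp add: b c)
  let ?B = "mat (n + 1) (n + 1) (\<lambda>(i, j). b i j)"
  let ?C = "mat (n + 1) (n + 1) (\<lambda>(i, j). c i j)"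
  have carrier: "?B \<in> carrier_mat (n + 1) (n + 1)" "?C \<in> carrier_mat (n + 1) (n + 1)" by auto
  have "(\<Sum>k = 0..<n + 1. b i k * c k j) = (if i = j then 1 else 0)" if "i < n + 1" "j < n + 1" for i j
  proof (cases "i \<le> j")
    case True
    have "(\<Sum>k = 0..<n + 1. b i k * c k j) = (\<Sum>k = i..j. b i k * c k j)"
      using that by (intro sum.mono_neutral_right) (auto simp: b c not_le)
    then show ?thesis using e True by simp
  next
    case False
    then have "b i k * c k j = 0" for k by (cases "k < i") (auto simp: b c)
    then have "(\<Sum>k = 0..<n + 1. b i k * c k j) = 0" by (intro sum.neutral ballI)
    then show ?thesis using False by simp
  qed
  then have BC: "?B * ?C = 1\<^sub>m (n + 1)"
    by (intro eq_matI) (auto simp: scalar_prod_def)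
  \<comment> \<open>For square matrices over a field, a one-sided inverse is two-sided.\<close>
  then have "?C * ?B = 1\<^sub>m (n + 1)"
    using mat_mult_left_right_inverse[OF carrier] by simp
  with BC show ?thesis by (simp add: is_inverse_mat_def inverts_mat_def)
qed

section \<open>Arithmetic of powers of \<open>p\<close> and \<open>x\<close>\<close>

lemma cong_iff_even_diff: "i \<le> j \<Longrightarrow> [i = j] (mod 2) \<longleftrightarrow> even (j - i)" for i j :: nat
  by (simp add: cong_def) presburger

definition triangular :: "nat \<Rightarrow> int" where
  "triangular j = int j * (int j + 1) div 2"

text \<open>Division-free form, so that comparing exponents becomes a ring identity over the
  integers.\<close>

lemma triangular_double: "2 * triangular j = int j * (int j + 1)"
  by (simp add: triangular_def)

text \<open>Genericity is expressed as multiplicative independence of \<open>p\<close> and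
  \<open>x\<close>: it keeps the denominators nonzero and the eigenvalues distinct.\<close>

locale independent_parameters =
  fixes p :: nat and x :: "'a::field"
  assumes p_nonzero: "of_nat p \<noteq> (0::'a)" and x_nonzero: "x \<noteq> 0"
    and independent: "p_pow p x a b = 1 \<Longrightarrow> a = 0 \<and> b = 0"
begin

abbreviation "pw \<equiv> p_pow p x"
abbreviation "Q \<equiv> (of_nat p ^ 2 :: 'a)"

lemma pw_add: "pw a b * pw c d = pw (a + c) (b + d)"
  using p_nonzero x_nonzero by (simp add: p_pow_def power_int_add power_int_diff field_simps power_int_minus)

lemma pw_divide: "pw a b / pw c d = pw (a - c) (b - d)"
  using p_nonzero x_nonzero by (simp add: p_pow_def power_int_diff field_simps power_int_minus)

lemma pw_0 [simp]: "pw 0 0 = 1"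
  by (simp add: p_pow_def)

lemma pw_power: "pw a b ^ n = pw (a * int n) (b * int n)"
  by (induction n) (simp_all add: pw_add distrib_left add_ac)

lemma pw_nonzero [simp]: "pw a b \<noteq> 0"
  using p_nonzero x_nonzero by (simp add: p_pow_def)

lemma pw_eq_iff: "pw a b = pw c d \<longleftrightarrow> a = c \<and> b = d"
proof
  assume "pw a b = pw c d"
  then have "pw (a - c) (b - d) = 1" by (simp flip: pw_divide)
  then show "a = c \<and> b = d" using independent by fastforce
qed simp

lemma pw_eq_1_iff: "pw a b = 1 \<longleftrightarrow> a = 0 \<and> b = 0"
  using pw_eq_iff[of a b 0 0] by simp

lemma of_nat_power_eq_pw: "of_nat p ^ k = pw (int k) 0"
  by (simp add: p_pow_def)

lemma Q_power: "Q ^ k = pw (2 * int k) 0"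
  unfolding power_mult[symmetric] unfolding of_nat_power_eq_pw by simp

lemma Q_nonzero: "Q \<noteq> 0"
  using p_nonzero by simp

lemma Q_power_neq_1: "k > 0 \<Longrightarrow> Q ^ k \<noteq> 1"
  by (simp add: Q_power pw_eq_1_iff)

text \<open>\<open>yy j\<close> is p^(2j-1-2s), the factor with the largest exponent in the
  denominator products of column \<open>j\<close>, for either parity of
  \<open>j - i\<close>.\<close>

abbreviation yy :: "nat \<Rightarrow> 'a" where "yy j \<equiv> pw (2 * int j - 1) (- 2)"
abbreviation zz :: "nat \<Rightarrow> 'a" where "zz j \<equiv> pw (int j) (- 1)"

lemma yy_neq: "yy j \<noteq> Q ^ u"
  by (simp add: Q_power pw_eq_iff)

lemma zz_neq_1: "1 - zz j \<noteq> 0"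
  using pw_eq_1_iff[of "int j" "- 1"] by auto

lemmas sum_qterm_yy = sum_qterm[OF Q_nonzero Q_power_neq_1 yy_neq]

lemma qterm_yy: "qterm Q (yy j) l s =
  pw (int s * (2 * int j + 1 - 2 * int l)) (- 2 * int s)
    / (qfact Q s * qfact Q (l - s) * qpoch Q (yy j) s)"
proof -
  have "yy j * Q / Q ^ l = pw (2 * int j + 1 - 2 * int l) (- 2)"
    using Q_power[of 1] unfolding Q_power[of l] by (simp add: pw_add pw_divide add_ac)
  then show ?thesis by (simp add: qterm_def pw_power mult_ac)
qed

lemma zz_divide: "zz j / Q ^ s = pw (int j - 2 * int s) (- 1)"
  by (simp add: Q_power pw_divide)

section \<open>The rows of B as left eigenvectors of m\<close>

definition eigenvalue :: "nat \<Rightarrow> 'a" where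
  "eigenvalue j = pw (- triangular j) (int j)"

lemma eigenvalue_distinct: "i \<noteq> j \<Longrightarrow> eigenvalue i \<noteq> eigenvalue j"
  by (simp add: eigenvalue_def pw_eq_iff)

lemma b_entry_below: "j < i \<Longrightarrow> b_entry m p x i j = 0"
  by (simp add: b_entry.simps)

lemma b_entry_diag: "b_entry m p x i i = 1"
  by (simp add: b_entry.simps)

text \<open>The prefactor of the recursion is \<open>1 / eigenvalue j\<close> over
  \<open>eigenvalue i / eigenvalue j - 1\<close>. Hence its sum over \<open>k < j\<close> equals
  \<open>(eigenvalue i - eigenvalue j) * b_entry m p x i j\<close>, and the term
  \<open>k = j\<close> supplies the part with \<open>eigenvalue j\<close>.\<close>

lemma b_entry_left_eigenvector:
  assumes m: "\<And>j. m j j = eigenvalue j" and ij: "i \<le> j"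
  shows "(\<Sum>k = i..j. b_entry m p x i k * m k j) = eigenvalue i * b_entry m p x i j"
proof (cases "i = j")
  case True
  then show ?thesis by (simp add: m b_entry_diag)
next
  case False
  define S where "S = (\<Sum>k = i..<j. m k j * b_entry m p x i k)"
  define e where "e = pw ((int j - int i) * (int j + int i + 1) div 2) (- (int j - int i))"
  have "(int j - int i) * (int j + int i + 1) div 2 = triangular j - triangular i"
  proof -
    have "(int j - int i) * (int j + int i + 1) = 2 * (triangular j - triangular i)"
      using triangular_double[of i] triangular_double[of j] by (simp add: algebra_simps)
    then show ?thesis by simp
  qed
  then have e: "e = eigenvalue i / eigenvalue j"
    by (simp add: e_def eigenvalue_def pw_divide)
  then have e1: "e \<noteq> 1"
    using eigenvalue_distinct[OF False] by (simp add: eigenvalue_def)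
  have "b_entry m p x i j = pw (triangular j) (- int j) / (e - 1) * S"
    using ij False
    by (subst b_entry.simps) (simp add: Let_def triangular_def e_def S_def)
  also have "pw (triangular j) (- int j) = 1 / eigenvalue j"
    using pw_divide[of 0 0 "- triangular j" "int j"] by (simp add: eigenvalue_def)
  finally have "b_entry m p x i j = 1 / eigenvalue j / (e - 1) * S" .
  then have "b_entry m p x i j * (eigenvalue i - eigenvalue j) = S"
    using e1 eigenvalue_distinct[OF False] unfolding e
    by (simp add: divide_simps eigenvalue_def)
  moreover have "(\<Sum>k = i..j. b_entry m p x i k * m k j) = S + b_entry m p x i j * m j j"
    using ij by (simp add: sum.last_plus S_def mult.commute)
  ultimately show ?thesis by (simp add: m algebra_simps)
qed

section \<open>Closed forms for m and c\<close>

definition pfact :: "nat \<Rightarrow> nat \<Rightarrow> 'a" where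
  "pfact i j = (\<Prod>k = i + 1..j. of_nat p ^ k - 1)"

text \<open>This telescoping removes \<open>k\<close> from the numerators of
  \<open>m i k * c k j\<close>.\<close>

lemma pfact_mult: "i \<le> k \<Longrightarrow> k \<le> j \<Longrightarrow> pfact i k * pfact k j = pfact i j"
  unfolding pfact_def using prod.ub_add_nat[of "i + 1" k "\<lambda>k. of_nat p ^ k - 1 :: 'a" "j - k"] by simp

lemma pfact_self [simp]: "pfact i i = 1"
  by (simp add: pfact_def)

lemma qfact_Q: "qfact Q l = (\<Prod>k = 1..l. of_nat p ^ (2 * k) - 1)"
  by (simp add: qfact_def power_mult)

text \<open>With \<open>r\<close> the integer part of (k-i)/2, the exponents (k-i)(k-i+2)/4 and
  ((k-i)^2-1)/4 both equal r(r+1), so one formula serves both parities.\<close>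

lemma m_chi0_eq:
  assumes k: "k = i + 2 * r \<or> k = i + 2 * r + 1"
  shows "m_chi0 p x i k =
    pw (- triangular k + int r * (int r + 1)) (int i) * pfact i k / qfact Q r"
proof -
  have "2 * int r * (2 * int r + 2) div 4 = int r * (int r + 1)"
    by (simp add: algebra_simps)
  moreover have "((2 * int r + 1)\<^sup>2 - 1) div 4 = int r * (int r + 1)"
    by (simp add: algebra_simps power2_eq_square)
  ultimately show ?thesis
    using k by (auto simp: m_chi0_def Let_def triangular_def pfact_def qfact_Q add_ac)
qed

lemma m_chip_even:
  "m_chip p x i (i + 2 * r) =
    of_int (Legendre (- 1) (int p)) ^ r * pw (- triangular (i + 2 * r) + int r * int r) (int i)
      * pfact i (i + 2 * r) / qfact Q r"
proof -
  have "(2 * int r)\<^sup>2 div 4 = int r * int r"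
    by (simp add: algebra_simps power2_eq_square)
  then show ?thesis
    by (simp add: m_chip_def Let_def triangular_def pfact_def qfact_Q)
qed

lemma m_chip_odd: "odd (j - i) \<Longrightarrow> m_chip p x i j = 0"
  by (simp add: m_chip_def)

text \<open>The claimed entries, extended by 0 below the diagonal. The claimed product, read from
  its last factor down, is \<open>qpoch Q (yy j) h\<close> in both parities, which therefore differ
  only by \<open>1 - zz i\<close> and the parity of the exponent of \<open>x\<close>.\<close>

definition c_chi0 :: "nat \<Rightarrow> nat \<Rightarrow> 'a" where
  "c_chi0 i j =
    (let h = (j - i) div 2 in
     if j < i then 0
     else pw (int h * (int h + 1)) (- (int j - int i)) * (if even (j - i) then 1 - zz i else 1)
       * pfact i j / ((1 - zz j) * (qpoch Q (yy j) h * qfact Q h)))"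

text \<open>The value 0 for odd \<open>j - i\<close> follows the zero pattern of
  \<open>m_chip\<close> and completes the claimed entries to a full matrix.\<close>

definition c_chip :: "nat \<Rightarrow> nat \<Rightarrow> 'a" where
  "c_chip i j =
    (let h = (j - i) div 2 in
     if j < i \<or> odd (j - i) then 0
     else of_int (Legendre (- 1) (int p)) ^ h * pw (int h * int h) (- 2 * int h)
       * pfact i j / (qpoch Q (yy j) h * qfact Q h))"

text \<open>The part of \<open>m_chi0 p x i k * c_chi0 k j\<close> independent of \<open>k\<close>;
  \<open>l\<close> stands for the integer part of (j-i)/2.\<close>

definition chi0_factor :: "nat \<Rightarrow> nat \<Rightarrow> nat \<Rightarrow> 'a" where
  "chi0_factor i j l = pfact i j * pw (int l * (int l + 1) - triangular j) (int i) / (1 - zz j)"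

lemma c_chi0_eq_even:
  assumes "j = i + 2 * s"
  shows "c_chi0 i j = pw (int s * (int s + 1)) (- (2 * int s)) * (1 - zz i) * pfact i j
    / ((1 - zz j) * (qpoch Q (yy j) s * qfact Q s))"
proof -
  have "int j - int i = 2 * int s" "(j - i) div 2 = s" "even (j - i)" "\<not> j < i" using assms by auto
  then show ?thesis by (simp only: c_chi0_def Let_def if_True if_False)
qed

lemma c_chi0_eq_odd:
  assumes "j = i + 2 * s + 1"
  shows "c_chi0 i j = pw (int s * (int s + 1)) (- (2 * int s + 1)) * pfact i j
    / ((1 - zz j) * (qpoch Q (yy j) s * qfact Q s))"
proof -
  have "int j - int i = 2 * int s + 1" "(j - i) div 2 = s" "odd (j - i)" "\<not> j < i" using assms by auto
  then show ?thesis by (simp only: c_chi0_def Let_def if_True if_False mult_1_right)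
qed

section \<open>Right eigenvectors for the trivial character\<close>

lemma chi0_term_even:
  assumes k: "k = i + 2 * r \<or> k = i + 2 * r + 1" and j: "j = k + 2 * s" and l: "l = r + s"
  shows "m_chi0 p x i k * c_chi0 k j = chi0_factor i j l * (qterm Q (yy j) l s * (1 - zz j / Q ^ s))"
proof -
  have diff_eq: "l - s = r" using l by simp
  have "- triangular k + int r * (int r + 1) + int s * (int s + 1)
      = int l * (int l + 1) - triangular j + int s * (2 * int j + 1 - 2 * int l)"
    using triangular_double[of k] triangular_double[of j] k by (auto simp: l j algebra_simps)
  then have pws: "pw (- triangular k + int r * (int r + 1)) (int i) * pw (int s * (int s + 1)) (- (2 * int s))
      = pw (int l * (int l + 1) - triangular j) (int i)
        * pw (int s * (2 * int j + 1 - 2 * int l)) (- (2 * int s))"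
    by (simp only: pw_add)
  have "m_chi0 p x i k * c_chi0 k j
      = (pw (- triangular k + int r * (int r + 1)) (int i) * pw (int s * (int s + 1)) (- (2 * int s)))
        * (pfact i k * pfact k j) * (1 - zz k) / (qfact Q r * (1 - zz j) * (qpoch Q (yy j) s * qfact Q s))"
    unfolding m_chi0_eq[OF k] c_chi0_eq_even[OF j] times_divide_times_eq by (simp only: mult_ac)
  also have "pfact i k * pfact k j = pfact i j" using k j by (intro pfact_mult) auto
  \<comment> \<open>\<open>k = j - 2 * s\<close> turns the factor \<open>1 - zz k\<close> into the
    weight of the term.\<close>
  also have "zz k = zz j / Q ^ s" unfolding zz_divide by (simp add: j)
  finally show ?thesis
    unfolding pws chi0_factor_def qterm_yy using diff_eq by (simp add: mult_ac)
qed

text \<open>For odd \<open>j - k\<close> there is no factor \<open>1 - zz k\<close>; the exponents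
  instead leave the surplus \<open>zz j / Q ^ s\<close>, which complements the weight in
  \<open>chi0_term_even\<close> to 1.\<close>

lemma chi0_term_odd_of_even:
  assumes k: "k = i + 2 * r" and j: "j = k + 2 * s + 1" and l: "l = r + s"
  shows "m_chi0 p x i k * c_chi0 k j = chi0_factor i j l * (qterm Q (yy j) l s * (zz j / Q ^ s))"
proof -
  have diff_eq: "l - s = r" using l by simp
  have "- triangular k + int r * (int r + 1) + int s * (int s + 1)
      = int l * (int l + 1) - triangular j + int s * (2 * int j + 1 - 2 * int l) + (int j - 2 * int s)"
    using triangular_double[of k] triangular_double[of j] k by (auto simp: l j algebra_simps)
  then have pws: "pw (- triangular k + int r * (int r + 1)) (int i) * pw (int s * (int s + 1)) (- (2 * int s + 1))
      = pw (int l * (int l + 1) - triangular j) (int i)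
        * (pw (int s * (2 * int j + 1 - 2 * int l)) (- (2 * int s)) * (zz j / Q ^ s))"
    by (simp add: pw_add zz_divide add_ac)
  have "m_chi0 p x i k * c_chi0 k j
      = (pw (- triangular k + int r * (int r + 1)) (int i) * pw (int s * (int s + 1)) (- (2 * int s + 1)))
        * (pfact i k * pfact k j) / (qfact Q r * (1 - zz j) * (qpoch Q (yy j) s * qfact Q s))"
    unfolding m_chi0_eq[OF disjI1[OF k]] c_chi0_eq_odd[OF j] times_divide_times_eq by (simp only: mult_ac)
  also have "pfact i k * pfact k j = pfact i j" using k j by (intro pfact_mult) auto
  finally show ?thesis
    unfolding pws chi0_factor_def qterm_yy using diff_eq by (simp add: mult_ac)
qed

text \<open>Since \<open>l = r + s + 1\<close>, \<open>qfact Q (l - s)\<close> has one factor more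
  than \<open>qfact Q r\<close>. Supplying it turns the surplus \<open>zz j / Q ^ l\<close> into a
  difference, whose sum with the weight in \<open>chi0_term_even\<close> is independent of
  \<open>s\<close>.\<close>

lemma chi0_term_odd_of_odd:
  assumes k: "k = i + 2 * r + 1" and j: "j = k + 2 * s + 1" and l: "l = r + s + 1"
  shows "m_chi0 p x i k * c_chi0 k j
    = chi0_factor i j l * (qterm Q (yy j) l s * (zz j / Q ^ s - zz j / Q ^ l))"
proof -
  have "- triangular k + int r * (int r + 1) + int s * (int s + 1)
      = int l * (int l + 1) - triangular j + int s * (2 * int j + 1 - 2 * int l) + (int j - 2 * int l)"
    using triangular_double[of k] triangular_double[of j] k by (auto simp: l j algebra_simps)
  then have pws: "pw (- triangular k + int r * (int r + 1)) (int i) * pw (int s * (int s + 1)) (- (2 * int s + 1))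
      = pw (int l * (int l + 1) - triangular j) (int i)
        * (pw (int s * (2 * int j + 1 - 2 * int l)) (- (2 * int s)) * (zz j / Q ^ l))"
    by (simp add: pw_add zz_divide add_ac)
  define D where "D = Q ^ Suc r - 1"
  have D: "D \<noteq> 0" using Q_power_neq_1[of "Suc r"] by (simp add: D_def)
  have f: "qfact Q (l - s) = qfact Q r * D" by (simp add: l D_def qfact_Suc)
  have "Q ^ l = Q ^ s * Q ^ Suc r" by (simp add: l power_add)
  then have z: "zz j / Q ^ s - zz j / Q ^ l = zz j / Q ^ l * D"
    using Q_nonzero by (simp add: D_def field_simps)
  have "m_chi0 p x i k * c_chi0 k j
      = (pw (- triangular k + int r * (int r + 1)) (int i) * pw (int s * (int s + 1)) (- (2 * int s + 1)))
        * (pfact i k * pfact k j) / (qfact Q r * (1 - zz j) * (qpoch Q (yy j) s * qfact Q s))"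
    unfolding m_chi0_eq[OF disjI2[OF k]] c_chi0_eq_odd[OF j] times_divide_times_eq by (simp only: mult_ac)
  also have "pfact i k * pfact k j = pfact i j" using k j by (intro pfact_mult) auto
  finally show ?thesis
    unfolding pws z chi0_factor_def qterm_yy f using D by (simp add: mult_ac)
qed

lemma eigenvalue_mult_c_chi0:
  assumes "i \<le> j" and l: "l = (j - i) div 2"
  shows "eigenvalue j * c_chi0 i j
    = chi0_factor i j l * ((if even (j - i) then 1 - zz j / Q ^ l else 1) / (qfact Q l * qpoch Q (yy j) l))"
proof -
  have "eigenvalue j * pw (int l * (int l + 1)) (- (int j - int i)) = pw (int l * (int l + 1) - triangular j) (int i)"
    by (simp add: eigenvalue_def pw_add)
  moreover have "zz i = zz j / Q ^ l" if "even (j - i)"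
  proof -
    have "i = j - 2 * l" using that assms by (auto elim!: evenE)
    moreover have "2 * l \<le> j" using l by auto
    ultimately show ?thesis by (simp add: zz_divide of_nat_diff)
  qed
  ultimately show ?thesis
    using assms(1) by (simp add: c_chi0_def chi0_factor_def mult_ac flip: l)
qed

lemma c_chi0_right_eigenvector:
  assumes "i \<le> j"
  shows "(\<Sum>k = i..j. m_chi0 p x i k * c_chi0 k j) = eigenvalue j * c_chi0 i j"
proof -
  define l where "l = (j - i) div 2"
  let ?W = "\<lambda>s. qterm Q (yy j) l s"
  show ?thesis
  proof (cases "even (j - i)")
    case True
    then have j: "j = i + 2 * l" using assms by (auto simp: l_def)
    have "m_chi0 p x i (j - 2 * s) * c_chi0 (j - 2 * s) j
      = chi0_factor i j l * (?W s * (1 - zz j / Q ^ s))" if "s \<le> l" for s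
      using that by (intro chi0_term_even[where r = "l - s"]) (auto simp: j)
    moreover have "m_chi0 p x i (j - (2 * s + 1)) * c_chi0 (j - (2 * s + 1)) j
      = chi0_factor i j l * (?W s * (zz j / Q ^ s - zz j / Q ^ l))" if "s < l" for s
      using that by (intro chi0_term_odd_of_odd[where r = "l - Suc s"]) (auto simp: j)
    ultimately have "(\<Sum>k = i..j. m_chi0 p x i k * c_chi0 k j)
      = (\<Sum>s\<le>l. chi0_factor i j l * (?W s * (1 - zz j / Q ^ s)))
      + (\<Sum>s<l. chi0_factor i j l * (?W s * (zz j / Q ^ s - zz j / Q ^ l)))"
      unfolding sum_parity_even[of _ i l, folded j]
      by (intro arg_cong2[of _ _ _ _ "(+)"] sum.cong refl) simp_all
    \<comment> \<open>The second sum may be extended to \<open>s = l\<close>, where its weight is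
      0.\<close>
    also have "\<dots> = chi0_factor i j l *
       ((\<Sum>s\<le>l. ?W s * (1 - zz j / Q ^ s)) + (\<Sum>s\<le>l. ?W s * (zz j / Q ^ s - zz j / Q ^ l)))"
      by (simp add: distrib_left lessThan_Suc_atMost[symmetric] flip: sum_distrib_left)
    also have "(\<Sum>s\<le>l. ?W s * (1 - zz j / Q ^ s)) + (\<Sum>s\<le>l. ?W s * (zz j / Q ^ s - zz j / Q ^ l))
        = (\<Sum>s\<le>l. ?W s) * (1 - zz j / Q ^ l)"
      unfolding sum.distrib[symmetric] distrib_left[symmetric] sum_distrib_right by simp
    finally show ?thesis
      using True by (simp add: sum_qterm_yy eigenvalue_mult_c_chi0[OF assms l_def])
  next
    case False
    then have j: "j = i + 2 * l + 1" using assms unfolding l_def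
      by (metis add.assoc le_add_diff_inverse odd_two_times_div_two_succ)
    have "m_chi0 p x i (j - 2 * s) * c_chi0 (j - 2 * s) j
      = chi0_factor i j l * (?W s * (1 - zz j / Q ^ s))" if "s \<le> l" for s
      using that by (intro chi0_term_even[where r = "l - s"]) (auto simp: j)
    moreover have "m_chi0 p x i (j - (2 * s + 1)) * c_chi0 (j - (2 * s + 1)) j
      = chi0_factor i j l * (?W s * (zz j / Q ^ s))" if "s \<le> l" for s
      using that by (intro chi0_term_odd_of_even[where r = "l - s"]) (auto simp: j)
    ultimately have "(\<Sum>k = i..j. m_chi0 p x i k * c_chi0 k j)
      = (\<Sum>s\<le>l. chi0_factor i j l * (?W s * (1 - zz j / Q ^ s)))
      + (\<Sum>s\<le>l. chi0_factor i j l * (?W s * (zz j / Q ^ s)))"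
      unfolding sum_parity_odd[of _ i l, folded j]
      by (intro arg_cong2[of _ _ _ _ "(+)"] sum.cong refl) simp_all
    also have "\<dots> = chi0_factor i j l * (\<Sum>s\<le>l. ?W s)"
      unfolding sum.distrib[symmetric] distrib_left[symmetric] sum_distrib_left by simp
    finally show ?thesis
      using False by (simp add: sum_qterm_yy eigenvalue_mult_c_chi0[OF assms l_def])
  qed
qed

section \<open>Right eigenvectors for the quadratic character\<close>

definition chip_factor :: "nat \<Rightarrow> nat \<Rightarrow> nat \<Rightarrow> 'a" where
  "chip_factor i j l =
    of_int (Legendre (- 1) (int p)) ^ l * pfact i j * pw (int l * int l - triangular j) (int i)"

text \<open>The signs combine because \<open>l = r + s\<close>. No weight depending on
  \<open>s\<close> remains, so \<open>sum_qterm\<close> applies directly.\<close>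

lemma chip_term:
  assumes k: "k = i + 2 * r" and j: "j = k + 2 * s" and l: "l = r + s"
  shows "m_chip p x i k * c_chip k j = chip_factor i j l * qterm Q (yy j) l s"
proof -
  have diff_eq: "l - s = r" using l by simp
  have "- triangular k + int r * int r + int s * int s
      = int l * int l - triangular j + int s * (2 * int j + 1 - 2 * int l)"
    using triangular_double[of k] triangular_double[of j] k by (auto simp: l j algebra_simps)
  then have pws: "pw (- triangular k + int r * int r) (int i) * pw (int s * int s) (- (2 * int s))
      = pw (int l * int l - triangular j) (int i)
        * pw (int s * (2 * int j + 1 - 2 * int l)) (- (2 * int s))"
    by (simp only: pw_add)
  have "m_chip p x i k * c_chip k j
      = of_int (Legendre (- 1) (int p)) ^ l
        * (pw (- triangular k + int r * int r) (int i) * pw (int s * int s) (- (2 * int s)))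
        * (pfact i k * pfact k j) / (qfact Q r * (qpoch Q (yy j) s * qfact Q s))"
    using j m_chip_even[of i r] unfolding k[symmetric] by (simp add: c_chip_def l power_add mult_ac)
  also have "pfact i k * pfact k j = pfact i j" using k j by (intro pfact_mult) auto
  finally show ?thesis
    unfolding pws chip_factor_def qterm_yy using diff_eq by (simp add: mult_ac)
qed

lemma c_chip_right_eigenvector:
  assumes "i \<le> j"
  shows "(\<Sum>k = i..j. m_chip p x i k * c_chip k j) = eigenvalue j * c_chip i j"
proof (cases "even (j - i)")
  case True
  define l where "l = (j - i) div 2"
  have j: "j = i + 2 * l" using assms True by (auto simp: l_def)
  have "m_chip p x i (j - 2 * s) * c_chip (j - 2 * s) j
      = chip_factor i j l * qterm Q (yy j) l s" if "s \<le> l" for s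
    using that by (intro chip_term[where r = "l - s"]) (auto simp: j)
  moreover have "c_chip (j - (2 * s + 1)) j = 0" if "s < l" for s
    using that by (auto simp: c_chip_def j)
  ultimately have "(\<Sum>k = i..j. m_chip p x i k * c_chip k j)
      = (\<Sum>s\<le>l. chip_factor i j l * qterm Q (yy j) l s)"
    unfolding sum_parity_even[of _ i l, folded j] by simp
  also have "\<dots> = chip_factor i j l * (1 / (qfact Q l * qpoch Q (yy j) l))"
    by (simp add: sum_qterm_yy flip: sum_distrib_left)
  also have "chip_factor i j l = of_int (Legendre (- 1) (int p)) ^ l * pfact i j
      * (eigenvalue j * pw (int l * int l) (- (2 * int l)))"
    by (simp add: chip_factor_def eigenvalue_def pw_add) (simp add: j)
  finally show ?thesis by (simp add: c_chip_def j mult_ac)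
next
  case False
  \<comment> \<open>As \<open>j - i\<close> is odd, exactly one of \<open>k - i\<close> and
    \<open>j - k\<close> is odd, and the corresponding factor is 0.\<close>
  have "m_chip p x i k * c_chip k j = 0" if "k \<in> {i..j}" for k
  proof (cases "even (k - i)")
    case True
    then have "odd (j - k)" using False that by auto
    then show ?thesis by (simp add: c_chip_def)
  qed (simp add: m_chip_odd)
  then have "(\<Sum>k = i..j. m_chip p x i k * c_chip k j) = 0" by (intro sum.neutral ballI)
  then show ?thesis using False by (simp only: c_chip_def Let_def) simp
qed

section \<open>The inverse matrices\<close>

lemma is_inverse_mat_b_entry:
  assumes "\<And>j. m j j = eigenvalue j"
    and "\<And>i j. j < i \<Longrightarrow> c i j = 0" and "\<And>i. c i i = 1"
    and "\<And>i j. i \<le> j \<Longrightarrow> (\<Sum>k = i..j. m i k * c k j) = eigenvalue j * c i j"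
  shows "is_inverse_mat (mat (n + 1) (n + 1) (\<lambda>(i, j). c i j))
    (mat (n + 1) (n + 1) (\<lambda>(i, j). b_entry m p x i j))"
  by (rule inverse_of_eigenvector_matrices[of "b_entry m p x" c m eigenvalue,
        OF b_entry_below b_entry_diag assms(2,3) b_entry_left_eigenvector[of m, OF assms(1)] assms(4)
           eigenvalue_distinct[OF less_imp_neq]])

lemma is_inverse_mat_B_chi0:
  "is_inverse_mat (mat (n + 1) (n + 1) (\<lambda>(i, j). c_chi0 i j)) (B_chi0 p x n)"
  unfolding B_chi0_def
proof (rule is_inverse_mat_b_entry)
  show "m_chi0 p x j j = eigenvalue j" for j
    using m_chi0_eq[of j j 0] by (simp add: eigenvalue_def)
  show "c_chi0 i i = 1" for i
    using zz_neq_1[of i] by (simp add: c_chi0_def)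
  show "c_chi0 i j = 0" if "j < i" for i j
    using that by (simp add: c_chi0_def)
qed (rule c_chi0_right_eigenvector)

lemma is_inverse_mat_B_chip:
  "is_inverse_mat (mat (n + 1) (n + 1) (\<lambda>(i, j). c_chip i j)) (B_chip p x n)"
  unfolding B_chip_def
proof (rule is_inverse_mat_b_entry)
  show "m_chip p x j j = eigenvalue j" for j
    using m_chip_even[of j 0] by (simp add: eigenvalue_def)
  show "c_chip i i = 1" for i
    by (simp add: c_chip_def)
  show "c_chip i j = 0" if "j < i" for i j
    using that by (simp add: c_chip_def)
qed (rule c_chip_right_eigenvector)

section \<open>Agreement with the claimed formulas\<close>

lemma qpoch_mult_qfact:
  assumes "e = 2 * int j - 2 * int h - 1"
  shows "(\<Prod>k = 1..h. (1 - pw (e + 2 * int k) (- 2)) * (of_nat p ^ (2 * k) - 1))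
    = qpoch Q (yy j) h * qfact Q h"
proof -
  \<comment> \<open>Reversal by \<open>k = h - u\<close>: the last exponent
    \<open>e + 2 * int h\<close> is \<open>2 * int j - 1\<close>, that of \<open>yy j\<close>. The
    values i+j-1 and i+j of \<open>e\<close> cover the two parities.\<close>
  have "(\<Prod>k = 1..h. 1 - pw (e + 2 * int k) (- 2)) = (\<Prod>u<h. 1 - yy j / Q ^ u)"
    by (rule prod.reindex_bij_witness[of _ "\<lambda>u. h - u" "\<lambda>k. h - k"])
      (auto simp: Q_power pw_divide of_nat_diff assms algebra_simps)
  then show ?thesis by (simp add: prod.distrib qpoch_def qfact_Q)
qed

lemma c_chi0_even:
  assumes "i \<le> j" "[i = j] (mod 2)" and I: "I = int i" and J: "J = int j"
  shows "c_chi0 i j = pw ((J - I) * (J - I + 2) div 4) (- (J - I)) * (1 - pw I (- 1))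
      * (\<Prod>k = i+1..j. of_nat p ^ k - 1)
    / ((1 - pw J (- 1))
      * (\<Prod>k = 1..(j - i) div 2. (1 - pw (I + J - 1 + 2 * int k) (- 2)) * (of_nat p ^ (2 * k) - 1)))"
proof -
  obtain h where "j - i = 2 * h" using cong_iff_even_diff[OF assms(1)] assms(2) by (metis evenE)
  then have j: "j = i + 2 * h" using assms(1) by simp
  have exponent: "2 * int h * (2 * int h + 2) div 4 = int h * (int h + 1)"
    by (simp add: algebra_simps)
  have h: "(j - i) div 2 = h" "J - I = 2 * int h" and "I + J - 1 = 2 * int j - 2 * int h - 1"
    by (simp_all add: I J j)
  show ?thesis
    unfolding c_chi0_eq_even[OF j] h qpoch_mult_qfact[OF \<open>I + J - 1 = _\<close>] exponent pfact_def
    by (simp only: I J)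
qed

lemma c_chi0_odd:
  assumes "i \<le> j" "\<not> [i = j] (mod 2)" and I: "I = int i" and J: "J = int j"
  shows "c_chi0 i j = pw (((J - I)\<^sup>2 - 1) div 4) (- (J - I))
      * (\<Prod>k = i+1..j. of_nat p ^ k - 1)
    / ((1 - pw J (- 1))
      * (\<Prod>k = 1..(j - i - 1) div 2. (1 - pw (I + J + 2 * int k) (- 2)) * (of_nat p ^ (2 * k) - 1)))"
proof -
  obtain h where "j - i = 2 * h + 1" using cong_iff_even_diff[OF assms(1)] assms(2) by (metis oddE)
  then have j: "j = i + 2 * h + 1" using assms(1) by simp
  have exponent: "((2 * int h + 1)\<^sup>2 - 1) div 4 = int h * (int h + 1)"
    by (simp add: algebra_simps power2_eq_square)
  have h: "(j - i - 1) div 2 = h" "J - I = 2 * int h + 1" and "I + J = 2 * int j - 2 * int h - 1"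
    by (simp_all add: I J j)
  show ?thesis
    unfolding c_chi0_eq_odd[OF j] h qpoch_mult_qfact[OF \<open>I + J = _\<close>] exponent pfact_def
    by (simp only: I J)
qed

lemma c_chip_even:
  assumes "i \<le> j" "[i = j] (mod 2)" and I: "I = int i" and J: "J = int j" and h: "h = (J - I) div 2"
  shows "c_chip i j = of_int (Legendre (- 1) (int p)) ^ ((j - i) div 2) * pw (h * h) (- 2 * h)
      * (\<Prod>k = i+1..j. of_nat p ^ k - 1)
    / (\<Prod>k = 1..(j - i) div 2. (1 - pw (I + J - 1 + 2 * int k) (- 2)) * (of_nat p ^ (2 * k) - 1))"
proof -
  obtain g where "j - i = 2 * g" using cong_iff_even_diff[OF assms(1)] assms(2) by (metis evenE)
  then have j: "j = i + 2 * g" using assms(1) by simp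
  have g: "(j - i) div 2 = g" "h = int g" and "I + J - 1 = 2 * int j - 2 * int g - 1"
    by (simp_all add: I J j h)
  show ?thesis
    unfolding c_chip_def g qpoch_mult_qfact[OF \<open>I + J - 1 = _\<close>] pfact_def
    using assms(1) \<open>j - i = 2 * g\<close> by simp
qed

end

section \<open>Independence of p and the indeterminate\<close>

lemma ratfun_X_power: "ratfun_X ^ k = Fract (Polynomial.monom 1 k) 1"
  by (induction k) (simp_all add: ratfun_X_def One_fract_def Polynomial.monom_altdef one_pCons)

text \<open>Clearing negative exponents leaves an equality of two monomials over the complex
  numbers. Comparing degrees gives \<open>b = 0\<close>, comparing coefficients
  \<open>a = 0\<close>.\<close>

lemma ratfun_X_independent:
  assumes p: "p > 1" and "p_pow p ratfun_X a b = 1"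
  shows "a = 0 \<and> b = 0"
proof -
  define u where "u = (of_nat p :: complex poly fract)"
  have u: "u \<noteq> 0"
    using p by (simp add: u_def of_nat_fract Zero_fract_def eq_fract)
  have X: "ratfun_X \<noteq> 0"
    by (simp add: ratfun_X_def Zero_fract_def eq_fract)
  have split: "v powi c = v ^ nat c / v ^ nat (- c)" if "v \<noteq> 0" for v :: "complex poly fract" and c
    by (simp add: power_int_def divide_inverse power_inverse)
  have upow: "u ^ k = Fract [:of_nat (p ^ k):] 1" for k
    by (induction k) (simp_all add: u_def of_nat_fract of_nat_poly One_fract_def one_pCons mult.commute)
  have "u ^ nat a * ratfun_X ^ nat (- b) = u ^ nat (- a) * ratfun_X ^ nat b"
    using assms(2) u X by (simp add: p_pow_def split field_simps flip: u_def)
  then have eq: "Polynomial.monom (of_nat (p ^ nat a) :: complex) (nat (- b))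
      = Polynomial.monom (of_nat (p ^ nat (- a))) (nat b)"
    by (simp add: upow ratfun_X_power eq_fract Polynomial.smult_monom)
  have "nat (- b) = nat b"
    using arg_cong[OF eq, of Polynomial.degree] p by (simp add: Polynomial.degree_monom_eq)
  moreover from this have "p ^ nat a = p ^ nat (- a)"
    using eq by (metis Polynomial.coeff_monom of_nat_eq_iff)
  then have "nat a = nat (- a)" using p by (simp add: power_inject_exp)
  ultimately show ?thesis by linarith
qed

theorem proposition2p6:
  fixes p n :: nat
  assumes "prime p" and "odd p"
  shows
    "(\<exists>C. is_inverse_mat C (B_chi0 p ratfun_X n) \<and>
      (\<forall>i j. i \<le> j \<and> j \<le> n \<longrightarrow>
        (let I = int i; J = int j; q = p_pow p ratfun_X in
          ([i = j] (mod 2) \<longrightarrow>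
            C $$ (i, j) =
              q ((J - I) * (J - I + 2) div 4) (- (J - I)) * (1 - q I (- 1))
                * (\<Prod>k = i+1..j. of_nat p ^ k - 1)
              / ((1 - q J (- 1))
                * (\<Prod>k = 1..(j - i) div 2.
                    (1 - q (I + J - 1 + 2 * int k) (- 2)) * (of_nat p ^ (2 * k) - 1)))) \<and>
          (\<not> [i = j] (mod 2) \<longrightarrow>
            C $$ (i, j) =
              q (((J - I)\<^sup>2 - 1) div 4) (- (J - I))
                * (\<Prod>k = i+1..j. of_nat p ^ k - 1)
              / ((1 - q J (- 1))
                * (\<Prod>k = 1..(j - i - 1) div 2.
                    (1 - q (I + J + 2 * int k) (- 2)) * (of_nat p ^ (2 * k) - 1)))))))
    \<and>
    (\<exists>C. is_inverse_mat C (B_chip p ratfun_X n) \<and>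
      (\<forall>i j. i \<le> j \<and> j \<le> n \<and> [i = j] (mod 2) \<longrightarrow>
        (let I = int i; J = int j; h = (J - I) div 2; q = p_pow p ratfun_X in
          C $$ (i, j) =
            of_int (Legendre (- 1) (int p)) ^ ((j - i) div 2)
              * q (h * h) (- 2 * h)
              * (\<Prod>k = i+1..j. of_nat p ^ k - 1)
            / (\<Prod>k = 1..(j - i) div 2.
                (1 - q (I + J - 1 + 2 * int k) (- 2)) * (of_nat p ^ (2 * k) - 1)))))"
proof -
  interpret independent_parameters p ratfun_X
  proof
    have p: "p > 1" using assms(1) prime_gt_1_nat by blast
    then show "of_nat p \<noteq> (0 :: complex poly fract)"
      by (simp add: of_nat_fract Zero_fract_def eq_fract)
    show "ratfun_X \<noteq> 0"
      by (simp add: ratfun_X_def Zero_fract_def eq_fract)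
    show "a = 0 \<and> b = 0" if "p_pow p ratfun_X a b = 1" for a b
      using ratfun_X_independent[OF p that] .
  qed
  let ?C0 = "mat (n + 1) (n + 1) (\<lambda>(i, j). c_chi0 i j)"
  let ?Cp = "mat (n + 1) (n + 1) (\<lambda>(i, j). c_chip i j)"
  have entries: "?C0 $$ (i, j) = c_chi0 i j" "?Cp $$ (i, j) = c_chip i j" if "i \<le> j \<and> j \<le> n" for i j
    using that by auto
  show ?thesis
    unfolding Let_def
    by (rule conjI[OF exI[of _ ?C0] exI[of _ ?Cp]]; intro conjI allI impI)
      (simp_all only: is_inverse_mat_B_chi0 is_inverse_mat_B_chip entries c_chi0_even[OF _ _ refl refl]
        c_chi0_odd[OF _ _ refl refl] c_chip_even[OF _ _ refl refl refl] not_False_eq_True)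
qed

end
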